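(* Let $V(q,e)$ be a given virtual priority function of the virtual continuous time system described in the context. For each $(h,q,e)$, the optimal power control action in the HJB equation, i.e. the $p\in[0,e/\tau]$ attaining the minimum of $$\frac{q}{\overline{\lambda}\tau}+\frac{\partial V(q,e)}{\partial q}\big(-R(h,p)+\overline{\lambda}\big)+\frac{\partial V(q,e)}{\partial e}\big(-p+\overline{\alpha}\big),$$ is given by $$p^\ast=\min\left\{\left(-\frac{\partial V(q,e)}{\partial q}\bigg/\frac{\partial V(q,e)}{\partial e}-\frac{1}{|h|^2}\right)^+,\ \frac{e}{\tau}\right\}.$$
   Context: Constants $\tau,\overline{\lambda},\overline{\alpha},N_E>0$; $R(h,p)=\log(1+p|h|^2)$; $h\sim\mathcal{CN}(0,1)$; $x^+=\max\{x,0\}$. Virtual continuous time system: state $(q(t),e(t))\in[0,\infty)\times[0,N_E]$; a virtual policy $\Omega^v$ chooses $p(t)\ge0$ adapted to the history of $(h,q,e)$ with $p(t)\tau\le e(t)$; dynamics $$\mathrm{d}q=\big(-\mathbb{E}[R(h,p)|q,e]+\overline{\lambda}\big)\tau\,\mathrm{d}t+\mathrm{d}L,\qquad \mathrm{d}e=\big(-\mathbb{E}[p|q,e]+\overline{\alpha}\big)\tau\,\mathrm{d}t-\mathrm{d}U,$$ with $L,U$ ($L(0)=U(0)=0$) the minimal non-decreasing reflection processes keeping $q\ge0$ and $e\le N_E$. $\Omega^v$ is admissible if for every initial state the trajectory is unique and $\int_0^\infty q(t)\,\mathrm{d}t$ is bounded. The virtual priority function $V$ is a $\mathcal{C}^1(\mathbb{R}_+^2)$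 function satisfying the HJB equation $$\min_{0\le p\le e/\tau}\mathbb{E}\Big[\tfrac{q}{\overline{\lambda}\tau}+\tfrac{\partial V}{\partial q}(-R(h,p)+\overline{\lambda})+\tfrac{\partial V}{\partial e}(-p+\overline{\alpha})\Big|q,e\Big]=0\quad\forall q,e$$ (expectation over $h$; $p$ may depend on $h$) and, for every admissible $\Omega^v$ and initial state, $\limsup_{T\to\infty}\int_0^T\frac{\partial V(0,e(t))}{\partial q}\mathrm{d}L(t)=0$, $\limsup_{T\to\infty}\int_0^T\frac{\partial V(q(t),N_E)}{\partial e}\mathrm{d}U(t)=0$, $\limsup_{T\to\infty}V(q(T),e(T))=0$. It equals the optimal total cost: $V(q,e)=\min_{\Omega^v}\int_0^\infty q(t)/\overline{\lambda}\,\mathrm{d}t$ over admissible $\Omega^v$, starting from $(q(0),e(0))=(q,e)$. The quantity $-\frac{\partial V}{\partial q}\big/\frac{\partial V}{\partial e}$ is the water level; when $\frac{\partial V}{\partial e}=0$ it is taken to be $+\infty$, so that $p^\ast=e/\tau$. *)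

theory Defs
  imports "HOL-Probability.Probability"
begin

text \<open>
  The constants are passed explicitly: \<open>\<tau>\<close> (slot length), \<open>lam\<close> (mean data arrival rate),
  \<open>\<alpha>\<close> (mean energy arrival rate) and \<open>N\<close> (energy buffer size).
\<close>

definition CN01 :: "complex measure" where
  "CN01 = density lborel (\<lambda>z. ennreal (exp (- (cmod z)\<^sup>2) / pi))"

text \<open>Natural logarithm: the water-filling formula has no factor \<open>1 / ln 2\<close>.\<close>

definition rate :: "complex \<Rightarrow> real \<Rightarrow> real" where
  "rate h p = ln (1 + p * (cmod h)\<^sup>2)"

definition state_space :: "real \<Rightarrow> (real \<times> real) set" where
  "state_space N = {0..} \<times> {0..N}"

text \<open>
  \<open>\<Omega> t h q e\<close> is the power chosen at time \<open>t\<close> when the paths of channel, data queue and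
  energy queue are \<open>h\<close>, \<open>q\<close>, \<open>e\<close>.  Only their restrictions to \<open>[0, t]\<close> matter.
\<close>

type_synonym policy =
  "real \<Rightarrow> (real \<Rightarrow> complex) \<Rightarrow> (real \<Rightarrow> real) \<Rightarrow> (real \<Rightarrow> real) \<Rightarrow> real"

text \<open>Law of the channel history on \<open>[0, t]\<close>: independent \<open>CN(0,1)\<close> variables.\<close>

definition channel_history :: "real \<Rightarrow> (real \<Rightarrow> complex) measure" where
  "channel_history t = (\<Pi>\<^sub>M s\<in>{0..t}. CN01)"

definition virtual_policy :: "real \<Rightarrow> real \<Rightarrow> policy \<Rightarrow> bool" where
  "virtual_policy \<tau> N \<Omega> \<longleftrightarrow>
     (\<forall>t\<ge>0. \<forall>h q e h' q' e'.
        (\<forall>s\<in>{0..t}. h s = h' s \<and> q s = q' s \<and> e s = e' s) \<longrightarrow>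
        \<Omega> t h q e = \<Omega> t h' q' e') \<and>
     (\<forall>t\<ge>0. \<forall>q e. (\<lambda>h. \<Omega> t h q e) \<in> borel_measurable (channel_history t)) \<and>
     (\<forall>t\<ge>0. \<forall>h q e. (\<forall>s\<in>{0..t}. (q s, e s) \<in> state_space N) \<longrightarrow>
        0 \<le> \<Omega> t h q e \<and> \<Omega> t h q e * \<tau> \<le> e t)"

text \<open>
  The state path is deterministic, because its dynamics only involve expectations over the
  channel.  Hence the conditional expectations given \<open>(q, e)\<close> are integrals over the channel
  history with \<open>q\<close> and \<open>e\<close> held fixed.
\<close>

definition mean_rate ::
    "policy \<Rightarrow> (real \<Rightarrow> real) \<Rightarrow> (real \<Rightarrow> real) \<Rightarrow> real \<Rightarrow> real" where
  "mean_rate \<Omega> q e t = (LINT h|channel_history t. rate (h t) (\<Omega> t h q e))"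

definition mean_power ::
    "policy \<Rightarrow> (real \<Rightarrow> real) \<Rightarrow> (real \<Rightarrow> real) \<Rightarrow> real \<Rightarrow> real" where
  "mean_power \<Omega> q e t = (LINT h|channel_history t. \<Omega> t h q e)"

definition reflection :: "(real \<Rightarrow> real) \<Rightarrow> (real \<Rightarrow> real) \<Rightarrow> bool" where
  "reflection x L \<longleftrightarrow> L 0 = 0 \<and> mono_on {0..} L \<and> (\<forall>t\<ge>0. 0 \<le> x t + L t)"

definition minimal_reflection :: "(real \<Rightarrow> real) \<Rightarrow> (real \<Rightarrow> real) \<Rightarrow> bool" where
  "minimal_reflection x L \<longleftrightarrow>
     reflection x L \<and> (\<forall>L'. reflection x L' \<longrightarrow> (\<forall>t\<ge>0. L t \<le> L' t))"

text \<open>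
  The dynamics in integral form.  \<open>x\<close> and \<open>y\<close> are the unreflected paths, so that
  \<open>q = x + L\<close> with \<open>L\<close> minimal for \<open>q \<ge> 0\<close>, and \<open>e = y - U\<close> with \<open>U\<close> minimal for \<open>N - e \<ge> 0\<close>.
\<close>

definition trajectory ::
    "real \<Rightarrow> real \<Rightarrow> real \<Rightarrow> real \<Rightarrow> policy \<Rightarrow> real \<Rightarrow> real \<Rightarrow>
     (real \<Rightarrow> real) \<Rightarrow> (real \<Rightarrow> real) \<Rightarrow> (real \<Rightarrow> real) \<Rightarrow> (real \<Rightarrow> real) \<Rightarrow> bool" where
  "trajectory \<tau> lam \<alpha> N \<Omega> q0 e0 q e L U \<longleftrightarrow>
     (\<forall>t\<ge>0. (q t, e t) \<in> state_space N) \<and>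
     (\<forall>T\<ge>0. set_integrable lborel {0..T} (mean_rate \<Omega> q e) \<and>
            set_integrable lborel {0..T} (mean_power \<Omega> q e)) \<and>
     (let x = (\<lambda>t. q0 + (LINT s:{0..t}|lborel. (- mean_rate \<Omega> q e s + lam) * \<tau>));
          y = (\<lambda>t. e0 + (LINT s:{0..t}|lborel. (- mean_power \<Omega> q e s + \<alpha>) * \<tau>))
      in minimal_reflection x L \<and> (\<forall>t\<ge>0. q t = x t + L t) \<and>
         minimal_reflection (\<lambda>t. N - y t) U \<and> (\<forall>t\<ge>0. e t = y t - U t))"

definition admissible :: "real \<Rightarrow> real \<Rightarrow> real \<Rightarrow> real \<Rightarrow> policy \<Rightarrow> bool" where
  "admissible \<tau> lam \<alpha> N \<Omega> \<longleftrightarrow>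
     virtual_policy \<tau> N \<Omega> \<and>
     (\<forall>(q0, e0)\<in>state_space N.
        (\<exists>q e L U. trajectory \<tau> lam \<alpha> N \<Omega> q0 e0 q e L U) \<and>
        (\<forall>q e L U q' e' L' U'.
           trajectory \<tau> lam \<alpha> N \<Omega> q0 e0 q e L U \<longrightarrow>
           trajectory \<tau> lam \<alpha> N \<Omega> q0 e0 q' e' L' U' \<longrightarrow>
           (\<forall>t\<ge>0. q t = q' t \<and> e t = e' t)) \<and>
        (\<forall>q e L U. trajectory \<tau> lam \<alpha> N \<Omega> q0 e0 q e L U \<longrightarrow>
           set_integrable lborel {0..} q))"

text \<open>Partial derivatives on the closed quadrant, one-sided on its boundary.\<close>

definition d_q :: "(real \<Rightarrow> real \<Rightarrow> real) \<Rightarrow> real \<Rightarrow> real \<Rightarrow> real" where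
  "d_q V q e = vector_derivative (\<lambda>x. V x e) (at q within {0..})"

definition d_e :: "(real \<Rightarrow> real \<Rightarrow> real) \<Rightarrow> real \<Rightarrow> real \<Rightarrow> real" where
  "d_e V q e = vector_derivative (\<lambda>y. V q y) (at e within {0..})"

definition C1_quadrant :: "(real \<Rightarrow> real \<Rightarrow> real) \<Rightarrow> bool" where
  "C1_quadrant V \<longleftrightarrow>
     (\<forall>q\<ge>0. \<forall>e\<ge>0. (\<lambda>x. V x e) differentiable (at q within {0..}) \<and>
                  (\<lambda>y. V q y) differentiable (at e within {0..})) \<and>
     continuous_on ({0..} \<times> {0..}) (\<lambda>(q, e). d_q V q e) \<and>
     continuous_on ({0..} \<times> {0..}) (\<lambda>(q, e). d_e V q e)"

definition hjb_objective ::
    "real \<Rightarrow> real \<Rightarrow> real \<Rightarrow> (real \<Rightarrow> real \<Rightarrow> real) \<Rightarrow> real \<Rightarrow> real \<Rightarrow> complex \<Rightarrow> real \<Rightarrow> real" where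
  "hjb_objective \<tau> lam \<alpha> V q e h p =
     q / (lam * \<tau>) + d_q V q e * (- rate h p + lam) + d_e V q e * (- p + \<alpha>)"

definition power_rules :: "real \<Rightarrow> real \<Rightarrow> (complex \<Rightarrow> real) set" where
  "power_rules \<tau> e = {p \<in> borel_measurable borel. \<forall>h. p h \<in> {0..e / \<tau>}}"

definition HJB ::
    "real \<Rightarrow> real \<Rightarrow> real \<Rightarrow> real \<Rightarrow> (real \<Rightarrow> real \<Rightarrow> real) \<Rightarrow> bool" where
  "HJB \<tau> lam \<alpha> N V \<longleftrightarrow>
     (\<forall>(q, e)\<in>state_space N.
        (\<exists>p\<in>power_rules \<tau> e. (LINT h|CN01. hjb_objective \<tau> lam \<alpha> V q e h (p h)) = 0) \<and>
        (\<forall>p\<in>power_rules \<tau> e. (LINT h|CN01. hjb_objective \<tau> lam \<alpha> V q e h (p h)) \<ge> 0))"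

text \<open>
  Stieltjes integral of \<open>f\<close> over \<open>[0, T]\<close> with respect to \<open>dF\<close>.  \<open>interval_measure\<close> needs a
  function that is monotone on the whole line, so \<open>F\<close> is extended by \<open>F 0\<close> to negative times.
\<close>

definition stieltjes :: "(real \<Rightarrow> real) \<Rightarrow> (real \<Rightarrow> real) \<Rightarrow> real \<Rightarrow> real" where
  "stieltjes F f T = (LINT t:{0..T}|interval_measure (\<lambda>t. F (max 0 t)). f t)"

definition transversality ::
    "real \<Rightarrow> real \<Rightarrow> real \<Rightarrow> real \<Rightarrow> (real \<Rightarrow> real \<Rightarrow> real) \<Rightarrow> bool" where
  "transversality \<tau> lam \<alpha> N V \<longleftrightarrow>
     (\<forall>\<Omega>. admissible \<tau> lam \<alpha> N \<Omega> \<longrightarrow>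
       (\<forall>(q0, e0)\<in>state_space N. \<forall>q e L U. trajectory \<tau> lam \<alpha> N \<Omega> q0 e0 q e L U \<longrightarrow>
          Limsup at_top (\<lambda>T. ereal (stieltjes L (\<lambda>t. d_q V 0 (e t)) T)) = 0 \<and>
          Limsup at_top (\<lambda>T. ereal (stieltjes U (\<lambda>t. d_e V (q t) N) T)) = 0 \<and>
          Limsup at_top (\<lambda>T. ereal (V (q T) (e T))) = 0))"

definition achievable_costs ::
    "real \<Rightarrow> real \<Rightarrow> real \<Rightarrow> real \<Rightarrow> real \<Rightarrow> real \<Rightarrow> real set" where
  "achievable_costs \<tau> lam \<alpha> N q0 e0 =
     {(LINT t:{0..}|lborel. q t / lam) | \<Omega> q e L U.
        admissible \<tau> lam \<alpha> N \<Omega> \<and> trajectory \<tau> lam \<alpha> N \<Omega> q0 e0 q e L U}"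

definition optimal_total_cost ::
    "real \<Rightarrow> real \<Rightarrow> real \<Rightarrow> real \<Rightarrow> (real \<Rightarrow> real \<Rightarrow> real) \<Rightarrow> bool" where
  "optimal_total_cost \<tau> lam \<alpha> N V \<longleftrightarrow>
     (\<forall>(q0, e0)\<in>state_space N.
        V q0 e0 \<in> achievable_costs \<tau> lam \<alpha> N q0 e0 \<and>
        (\<forall>c\<in>achievable_costs \<tau> lam \<alpha> N q0 e0. V q0 e0 \<le> c))"

definition virtual_priority ::
    "real \<Rightarrow> real \<Rightarrow> real \<Rightarrow> real \<Rightarrow> (real \<Rightarrow> real \<Rightarrow> real) \<Rightarrow> bool" where
  "virtual_priority \<tau> lam \<alpha> N V \<longleftrightarrow>
     C1_quadrant V \<and> HJB \<tau> lam \<alpha> N V \<and> transversality \<tau> lam \<alpha> N V \<and>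
     optimal_total_cost \<tau> lam \<alpha> N V"

definition water_level :: "(real \<Rightarrow> real \<Rightarrow> real) \<Rightarrow> real \<Rightarrow> real \<Rightarrow> ereal" where
  "water_level V q e = (if d_e V q e = 0 then \<infinity> else ereal (- d_q V q e / d_e V q e))"

text \<open>
  Extended-real arithmetic: for \<open>h = 0\<close> the subtrahend is \<open>1 / 0 = \<infinity>\<close>, so a finite water level
  gives power \<open>0\<close>.  An infinite one gives \<open>e / \<tau>\<close> for every \<open>h\<close>, since \<open>\<infinity> - \<infinity> = \<infinity>\<close>
  for type \<open>ereal\<close>.
\<close>

definition opt_power ::
    "real \<Rightarrow> (real \<Rightarrow> real \<Rightarrow> real) \<Rightarrow> real \<Rightarrow> real \<Rightarrow> complex \<Rightarrow> real" where
  "opt_power \<tau> V q e h =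
     real_of_ereal (min (max (water_level V q e - 1 / ereal ((cmod h)\<^sup>2)) 0) (ereal (e / \<tau>)))"

end

theory Submission
  imports Defs
begin

text \<open>
  Water-filling minimises the objective as soon as \<open>d_q V \<ge> 0\<close> and \<open>d_e V \<le> 0\<close>.  These signs are
  not part of the HJB equation; they come from \<open>V\<close> being the optimal cost.  Given an optimal
  trajectory \<open>(q*, e*)\<close> from \<open>(q0, e0)\<close>, a controller started with less data and more energy can
  replay the optimal power process open loop: its energy dominates \<open>e*\<close>, so the powers are
  affordable, and its data queue is dominated by \<open>q*\<close>.  The replay is made admissible by switching
  the power off whenever the energy is below \<open>e*\<close>.  This only decreases the drain, so by monotonicity
  of the reflection map in the increments of the free path the switch is never used, and the
  trajectory is unique.
\<close>

section \<open>Reflection\<close>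

lemma reflection_nonneg: "reflection x L \<Longrightarrow> 0 \<le> t \<Longrightarrow> 0 \<le> L t"
  unfolding reflection_def by (metis atLeast_iff mono_onD order_refl)

text \<open>The pointwise infimum over all reflections works, because each of the three defining
  conditions survives the infimum. The assumption makes the family nonempty and nonnegativity bounds
  it below, as the real \<open>INF\<close> requires.\<close>

lemma minimal_reflection_exists:
  assumes "reflection x L"
  obtains M where "minimal_reflection x M"
proof
  define M where "M t = (INF R\<in>Collect (reflection x). R t)" for t
  have bdd: "bdd_below ((\<lambda>R. R t) ` Collect (reflection x))" if "0 \<le> t" for t
    using reflection_nonneg that by (intro bdd_belowI2[where m = 0]) auto
  have le: "M t \<le> R t" if "reflection x R" "0 \<le> t" for R t
    unfolding M_def using that bdd by (intro cINF_lower) auto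
  have ge: "c \<le> M t" if "\<And>R. reflection x R \<Longrightarrow> c \<le> R t" for c t
    unfolding M_def using that assms by (intro cINF_greatest) auto
  have "M 0 = 0"
    using le[OF assms, of 0] ge[of 0 0] assms by (force simp: reflection_def)
  moreover have "mono_on {0..} M"
  proof (intro mono_onI ge)
    fix s t :: real and R
    assume st: "s \<in> {0..}" "t \<in> {0..}" "s \<le> t" and R: "reflection x R"
    have "M s \<le> R s"
      using le[OF R] st by simp
    moreover have "R s \<le> R t"
      using R st unfolding reflection_def by (blast intro: mono_onD)
    ultimately show "M s \<le> R t" by linarith
  qed
  moreover have "0 \<le> x t + M t" if "0 \<le> t" for t
  proof -
    have "- x t \<le> M t"
      using that by (intro ge) (force simp: reflection_def)
    then show ?thesis by linarith
  qed
  ultimately show "minimal_reflection x M"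
    using le by (simp add: minimal_reflection_def reflection_def)
qed

lemma minimal_reflection_unique:
  "minimal_reflection x L \<Longrightarrow> minimal_reflection x L' \<Longrightarrow> 0 \<le> t \<Longrightarrow> L t = L' t"
  unfolding minimal_reflection_def by (meson order_antisym)

text \<open>\<open>L' + (x' - x)\<close> pushes \<open>x\<close> onto the nonnegative path
  \<open>x' + L'\<close> and is monotone as a sum. It starts at \<open>x' 0 - x 0\<close>, which may
  be positive, so its value at time 0 is reset to 0; there \<open>0 \<le> x 0\<close> takes
  over.\<close>

lemma reflection_transfer:
  assumes "reflection x' L'" and "mono_on {0..} (\<lambda>t. x' t - x t)"
    and "0 \<le> x 0" and "x 0 \<le> x' 0"
  shows "reflection x (\<lambda>t. if t = 0 then 0 else L' t + (x' t - x t))"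
proof -
  have mono: "L' s + (x' s - x s) \<le> L' t + (x' t - x t)" if "0 \<le> s" "s \<le> t" for s t
  proof (rule add_mono)
    show "L' s \<le> L' t"
      using assms(1) that by (intro mono_onD[of "{0..}" L']) (auto simp: reflection_def)
    show "x' s - x s \<le> x' t - x t"
      using mono_onD[OF assms(2), of s t] that by simp
  qed
  have nonneg: "0 \<le> L' t + (x' t - x t)" if "0 \<le> t" for t
    using mono[OF order_refl that] assms(1,4) by (simp add: reflection_def)
  have "mono_on {0..} (\<lambda>t. if t = 0 then 0 else L' t + (x' t - x t))"
  proof (rule mono_onI)
    fix s t :: real
    assume st: "s \<in> {0..}" "t \<in> {0..}" "s \<le> t"
    then show "(if s = 0 then 0 else L' s + (x' s - x s))
        \<le> (if t = 0 then 0 else L' t + (x' t - x t))"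
      using mono[of s t] nonneg[of t] by (cases "s = 0"; cases "t = 0") simp_all
  qed
  moreover have "0 \<le> x t + (if t = 0 then 0 else L' t + (x' t - x t))" if "0 \<le> t" for t
    using assms(1,3) that by (simp add: reflection_def add.commute)
  ultimately show ?thesis
    unfolding reflection_def by simp
qed

text \<open>The reflection transferred from \<open>L'\<close> competes with the minimal
  \<open>L\<close>, so \<open>L \<le> L' + (x' - x)\<close> at positive times. At time 0 both
  reflections vanish and the initial order decides.\<close>

lemma minimal_reflection_mono:
  assumes "minimal_reflection x L" and "reflection x' L'"
    and "mono_on {0..} (\<lambda>t. x' t - x t)" and "x 0 \<le> x' 0" and "0 \<le> t"
  shows "x t + L t \<le> x' t + L' t"
proof -
  have L: "L 0 = 0" "0 \<le> x 0 + L 0"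
    using assms(1) unfolding minimal_reflection_def reflection_def by blast+
  have "reflection x (\<lambda>t. if t = 0 then 0 else L' t + (x' t - x t))"
    using assms L by (intro reflection_transfer) auto
  then have "L t \<le> (if t = 0 then 0 else L' t + (x' t - x t))"
    using assms(1,5) unfolding minimal_reflection_def by blast
  then show ?thesis
    using assms(2,4) L by (auto simp: reflection_def split: if_splits)
qed

section \<open>Trajectories\<close>

text \<open>Common form of the two free paths, with drain \<open>r\<close> and inflow
  \<open>c\<close>, so that one comparison argument serves both queues.\<close>

definition fluid :: "real \<Rightarrow> real \<Rightarrow> real \<Rightarrow> (real \<Rightarrow> real) \<Rightarrow> real \<Rightarrow> real" where
  "fluid \<tau> c x0 r t = x0 + (LINT s:{0..t}|lborel. (- r s + c) * \<tau>)"

lemma trajectory_fluid: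
  "trajectory \<tau> lam \<alpha> N \<Omega> q0 e0 q e L U \<longleftrightarrow>
     (\<forall>t\<ge>0. (q t, e t) \<in> state_space N) \<and>
     (\<forall>T\<ge>0. set_integrable lborel {0..T} (mean_rate \<Omega> q e) \<and>
            set_integrable lborel {0..T} (mean_power \<Omega> q e)) \<and>
     minimal_reflection (fluid \<tau> lam q0 (mean_rate \<Omega> q e)) L \<and>
     (\<forall>t\<ge>0. q t = fluid \<tau> lam q0 (mean_rate \<Omega> q e) t + L t) \<and>
     minimal_reflection (\<lambda>t. N - fluid \<tau> \<alpha> e0 (mean_power \<Omega> q e) t) U \<and>
     (\<forall>t\<ge>0. e t = fluid \<tau> \<alpha> e0 (mean_power \<Omega> q e) t - U t)"
  unfolding trajectory_def fluid_def Let_def by blast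

lemma fluid_0 [simp]: "fluid \<tau> c x0 r 0 = x0"
proof -
  have "AE s in lborel. indicator {0..0} s *\<^sub>R ((- r s + c) * \<tau>) = 0"
    using AE_lborel_singleton[of "0::real"] by eventually_elim auto
  then have "(LINT s:{0..0}|lborel. (- r s + c) * \<tau>) = 0"
    unfolding set_lebesgue_integral_def by (rule integral_eq_zero_AE)
  then show ?thesis by (simp add: fluid_def)
qed

text \<open>For negative \<open>t\<close> the interval \<open>{0..t}\<close> is empty, so agreement
  at nonnegative times gives equality of functions, which can be rewritten inside
  \<open>minimal_reflection\<close>.\<close>

lemma fluid_cong: "(\<And>s. 0 \<le> s \<Longrightarrow> r s = r' s) \<Longrightarrow> fluid \<tau> c x0 r = fluid \<tau> c x0 r'"
  unfolding fluid_def
  by (intro ext arg_cong2[where f = "(+)"] refl set_lebesgue_integral_cong) auto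

lemma fluid_shift: "fluid \<tau> c x0 r t = fluid \<tau> c x1 r t + (x0 - x1)"
  by (simp add: fluid_def)

lemma fluid_integrable:
  fixes r :: "real \<Rightarrow> real"
  assumes "\<And>T. 0 \<le> T \<Longrightarrow> set_integrable lborel {0..T} r"
  shows "set_integrable lborel {0..t} (\<lambda>s. (- r s + c) * \<tau>)"
proof (cases "0 \<le> t")
  case True
  have "set_integrable lborel {0..t} (\<lambda>s. c)"
    unfolding set_integrable_def
    by (rule borel_integrable_compact) auto
  then have "set_integrable lborel {0..t} (\<lambda>s. (c - r s) * \<tau>)"
    using assms[OF True] by auto
  then show ?thesis by (simp add: algebra_simps)
qed (simp add: set_integrable_def)

text \<open>The difference is a constant plus the integral of \<open>(r' - r) * \<tau>\<close>, a
  nonnegative integrand.\<close>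

lemma fluid_diff_mono:
  assumes r: "\<And>T. 0 \<le> T \<Longrightarrow> set_integrable lborel {0..T} r"
    and r': "\<And>T. 0 \<le> T \<Longrightarrow> set_integrable lborel {0..T} r'"
    and le: "\<And>s. 0 \<le> s \<Longrightarrow> r s \<le> r' s" and "0 \<le> \<tau>"
  shows "mono_on {0..} (\<lambda>t. fluid \<tau> c x0 r t - fluid \<tau> c x0' r' t)"
proof (rule mono_onI)
  let ?d = "\<lambda>s. (- r s + c) * \<tau> - (- r' s + c) * \<tau>"
  fix s t :: real
  assume "s \<in> {0..}" "s \<le> t"
  have int: "set_integrable lborel {0..T} ?d" for T
    using fluid_integrable[OF r] fluid_integrable[OF r'] by (rule set_integral_diff)
  have eq: "fluid \<tau> c x0 r T - fluid \<tau> c x0' r' T = x0 - x0' + (LINT s:{0..T}|lborel. ?d s)" for T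
    using set_integral_diff(2)[OF fluid_integrable[OF r] fluid_integrable[OF r']]
    by (simp add: fluid_def)
  have "0 \<le> ?d u" if "0 \<le> u" for u
    using mult_right_mono[OF le[OF that] \<open>0 \<le> \<tau>\<close>] by (simp add: algebra_simps)
  then have "(LINT s:{0..s}|lborel. ?d s) \<le> (LINT s:{0..t}|lborel. ?d s)"
    using \<open>s \<le> t\<close> int unfolding set_lebesgue_integral_def set_integrable_def
    by (intro integral_mono) (auto simp: indicator_def)
  then show "fluid \<tau> c x0 r s - fluid \<tau> c x0' r' s \<le> fluid \<tau> c x0 r t - fluid \<tau> c x0' r' t"
    by (simp add: eq)
qed

section \<open>Replaying a trajectory\<close>

text \<open>The recorded path \<open>(qs, es)\<close> is fed to \<open>\<Omega>\<close> in place of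
  the actual one. The test at time 0 confines the change to a single initial state; from any other
  one \<open>\<Omega>\<close> acts as before, so admissibility is inherited there.\<close>

definition replay :: "policy \<Rightarrow> real \<Rightarrow> real \<Rightarrow> (real \<Rightarrow> real) \<Rightarrow> (real \<Rightarrow> real) \<Rightarrow> policy" where
  "replay \<Omega> q0 e0 qs es = (\<lambda>t h q e.
     if q 0 = q0 \<and> e 0 = e0 then (if es t \<le> e t then \<Omega> t h qs es else 0) else \<Omega> t h q e)"

text \<open>With the switch on, \<open>\<Omega> t h qs es * \<tau> \<le> es t \<le> e t\<close>;
  with it off, zero power is affordable. Both tests look only at times 0 and \<open>t\<close>, so
  the policy stays adapted.\<close>

lemma replay_virtual_policy:
  assumes \<Omega>: "virtual_policy \<tau> N \<Omega>" and s: "\<And>t. 0 \<le> t \<Longrightarrow> (qs t, es t) \<in> state_space N"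
  shows "virtual_policy \<tau> N (replay \<Omega> q0 e0 qs es)"
  unfolding virtual_policy_def
proof (intro conjI allI impI)
  fix t :: real and h h' :: "real \<Rightarrow> complex" and q e q' e' :: "real \<Rightarrow> real"
  assume t: "0 \<le> t" and eq: "\<forall>s\<in>{0..t}. h s = h' s \<and> q s = q' s \<and> e s = e' s"
  have "\<Omega> t h q e = \<Omega> t h' q' e'"
    using \<Omega> t eq unfolding virtual_policy_def by blast
  moreover have "\<Omega> t h qs es = \<Omega> t h' qs es"
    using \<Omega> t eq unfolding virtual_policy_def by blast
  moreover have "q 0 = q' 0" "e 0 = e' 0" "e t = e' t"
    using t eq by auto
  ultimately show "replay \<Omega> q0 e0 qs es t h q e = replay \<Omega> q0 e0 qs es t h' q' e'"
    by (simp add: replay_def)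
next
  fix t :: real and q e :: "real \<Rightarrow> real"
  assume "0 \<le> t"
  then have "(\<lambda>h. \<Omega> t h q e) \<in> borel_measurable (channel_history t)" for q e
    using \<Omega> by (simp add: virtual_policy_def)
  then show "(\<lambda>h. replay \<Omega> q0 e0 qs es t h q e) \<in> borel_measurable (channel_history t)"
    unfolding replay_def by simp
next
  fix t :: real and h :: "real \<Rightarrow> complex" and q e :: "real \<Rightarrow> real"
  assume t: "0 \<le> t" and st: "\<forall>s\<in>{0..t}. (q s, e s) \<in> state_space N"
  have "0 \<le> \<Omega> t h q e \<and> \<Omega> t h q e * \<tau> \<le> e t"
    using \<Omega> t st unfolding virtual_policy_def by blast
  moreover have "0 \<le> \<Omega> t h qs es \<and> \<Omega> t h qs es * \<tau> \<le> es t"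
    using \<Omega> t s unfolding virtual_policy_def by simp
  moreover have "0 \<le> e t"
    using t st by (auto simp: state_space_def)
  ultimately show "0 \<le> replay \<Omega> q0 e0 qs es t h q e" and
      "replay \<Omega> q0 e0 qs es t h q e * \<tau> \<le> e t"
    by (auto simp: replay_def)
qed

lemma mean_replay_other:
  assumes "\<not> (q 0 = q0 \<and> e 0 = e0)"
  shows "mean_rate (replay \<Omega> q0 e0 qs es) q e = mean_rate \<Omega> q e"
    and "mean_power (replay \<Omega> q0 e0 qs es) q e = mean_power \<Omega> q e"
  using assms by (auto simp: replay_def mean_rate_def mean_power_def fun_eq_iff)

text \<open>The switch depends on the state path and not on the channel, so it comes out of the
  integral; zero power has rate \<open>ln 1 = 0\<close>.\<close>

lemma mean_replay:
  assumes "q 0 = q0" and "e 0 = e0"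
  shows "mean_rate (replay \<Omega> q0 e0 qs es) q e t = (if es t \<le> e t then mean_rate \<Omega> qs es t else 0)"
    and "mean_power (replay \<Omega> q0 e0 qs es) q e t = (if es t \<le> e t then mean_power \<Omega> qs es t else 0)"
  using assms by (auto simp: replay_def mean_rate_def mean_power_def rate_def)

lemma trajectory_start:
  assumes "trajectory \<tau> lam \<alpha> N \<Omega> q0 e0 q e L U"
  shows "q 0 = q0" and "e 0 = e0"
  using assms by (auto simp: trajectory_fluid minimal_reflection_def reflection_def)

lemma trajectory_state:
  "trajectory \<tau> lam \<alpha> N \<Omega> q0 e0 q e L U \<Longrightarrow> 0 \<le> t \<Longrightarrow> (q t, e t) \<in> state_space N"
  unfolding trajectory_def by blast

lemma trajectory_replay_other:
  assumes "\<not> (q1 = q0 \<and> e1 = e0)"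
  shows "trajectory \<tau> lam \<alpha> N (replay \<Omega> q0 e0 qs es) q1 e1 q e L U \<longleftrightarrow>
    trajectory \<tau> lam \<alpha> N \<Omega> q1 e1 q e L U"
proof (cases "q 0 = q1 \<and> e 0 = e1")
  case True
  then show ?thesis
    using assms by (simp add: trajectory_def mean_replay_other)
next
  \<comment> \<open>A trajectory begins at its prescribed initial state, so both sides are
    false.\<close>
  case False
  then show ?thesis by (metis trajectory_start)
qed

lemma mean_power_nonneg:
  assumes "virtual_policy \<tau> N \<Omega>" and "\<And>t. 0 \<le> t \<Longrightarrow> (q t, e t) \<in> state_space N" and "0 \<le> t"
  shows "0 \<le> mean_power \<Omega> q e t"
  unfolding mean_power_def using assms
  by (intro Bochner_Integration.integral_nonneg) (auto simp: virtual_policy_def)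

text \<open>Domination by \<open>q\<close> gives integrability once \<open>q'\<close> is measurable.
  Measurability holds because \<open>q'\<close> differs from \<open>q\<close> by monotone functions
  and a constant.\<close>

lemma integrable_reflected:
  fixes L L' :: "real \<Rightarrow> real"
  assumes int: "set_integrable lborel {0..} q" and L: "mono_on {0..} L" and L': "mono_on {0..} L'"
    and q': "\<And>t. 0 \<le> t \<Longrightarrow> 0 \<le> q' t \<and> q' t \<le> q t"
    and eq: "\<And>t. 0 \<le> t \<Longrightarrow> q' t = q t - L t + L' t + d"
  shows "set_integrable lborel {0..} q'"
proof -
  \<comment> \<open>Clamping the argument at 0 makes \<open>M\<close> monotone on the whole line and
    leaves it unchanged on \<open>{0..}\<close>.\<close>
  have *: "(\<lambda>t. M (max 0 t)) \<in> borel_measurable borel" if "mono_on {0..} M" for M :: "real \<Rightarrow> real"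
    using that by (intro borel_measurable_mono monoI) (auto intro: mono_onD)
  have [measurable]: "(\<lambda>t. indicator {0..} t *\<^sub>R q t) \<in> borel_measurable borel"
    using borel_measurable_integrable[OF int[unfolded set_integrable_def]] by simp
  have [measurable]: "(\<lambda>t. L (max 0 t)) \<in> borel_measurable borel"
    "(\<lambda>t. L' (max 0 t)) \<in> borel_measurable borel"
    by (rule *[of L] *[of L'], fact)+
  have "(\<lambda>t. indicator {0..} t *\<^sub>R q' t) = (\<lambda>t. indicator {0..} t *\<^sub>R q t
      + indicator {0..} t * (L' (max 0 t) - L (max 0 t) + d))"
    using eq by (auto simp: fun_eq_iff indicator_def)
  then have meas: "(\<lambda>t. indicator {0..} t *\<^sub>R q' t) \<in> borel_measurable lborel"
    by (simp only:) measurable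
  have "\<bar>q' t\<bar> \<le> \<bar>q t\<bar>" if "0 \<le> t" for t
    using q'[OF that] by simp
  with meas show ?thesis
    unfolding set_integrable_def
    by (intro Bochner_Integration.integrable_bound[OF int[unfolded set_integrable_def]])
       (auto simp: indicator_def)
qed

text \<open>Whether the switch is on or off, the replay spends at most the recorded mean power. The
  bound thus holds along every trajectory of the replay, with nothing presupposed about the
  switch.\<close>

lemma replay_energy_ge:
  assumes "0 \<le> \<tau>" and "virtual_policy \<tau> N \<Omega>" and tr: "trajectory \<tau> lam \<alpha> N \<Omega> q0 e0 q e L U"
    and tr': "trajectory \<tau> lam \<alpha> N (replay \<Omega> q0' e0' q e) q0' e0' q' e' L' U'"
    and "e0 \<le> e0'" and "0 \<le> t"
  shows "e t \<le> e' t"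
proof -
  let ?m = "mean_power \<Omega> q e" and ?m' = "mean_power (replay \<Omega> q0' e0' q e) q' e'"
  let ?y = "fluid \<tau> \<alpha> e0 ?m" and ?y' = "fluid \<tau> \<alpha> e0' ?m'"
  have "?m' s \<le> ?m s" if "0 \<le> s" for s
    using mean_power_nonneg[OF assms(2) trajectory_state[OF tr] that]
    by (simp add: mean_replay trajectory_start[OF tr'])
  then have "mono_on {0..} (\<lambda>t. ?y' t - ?y t)"
    using assms by (intro fluid_diff_mono) (auto simp: trajectory_fluid)
  \<comment> \<open>The gap between \<open>N\<close> and the energy is a path reflected at 0, so the
    comparison applies to the gaps, with the order reversed.\<close>
  then have "(N - ?y' t) + U' t \<le> (N - ?y t) + U t"
    using assms
    by (intro minimal_reflection_mono[where x = "\<lambda>t. N - ?y' t" and x' = "\<lambda>t. N - ?y t"])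
       (auto simp: trajectory_fluid minimal_reflection_def)
  then show ?thesis
    using assms by (simp add: trajectory_fluid)
qed

text \<open>The candidate is built as if the switch were always on: the recorded free paths are
  shifted to the new start and reflected minimally. Comparison puts its energy above
  \<open>e\<close>, so the switch is indeed on and the candidate solves the dynamics. The formula
  for \<open>q'\<close> later yields its measurability.\<close>

lemma replay_trajectory_exists:
  assumes "trajectory \<tau> lam \<alpha> N \<Omega> q0 e0 q e L U"
    and "0 \<le> q0'" "q0' \<le> q0" "e0 \<le> e0'" "e0' \<le> N"
  obtains q' e' L' U' where "trajectory \<tau> lam \<alpha> N (replay \<Omega> q0' e0' q e) q0' e0' q' e' L' U'"
    and "\<And>t. 0 \<le> t \<Longrightarrow> q' t \<le> q t" and "\<And>t. 0 \<le> t \<Longrightarrow> q' t = q t - L t + L' t + (q0' - q0)"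
proof -
  note tr = assms(1)[unfolded trajectory_fluid]
  let ?r = "mean_rate \<Omega> q e" and ?m = "mean_power \<Omega> q e"
  let ?x = "fluid \<tau> lam q0 ?r" and ?x' = "fluid \<tau> lam q0' ?r"
  let ?y = "\<lambda>t. N - fluid \<tau> \<alpha> e0 ?m t" and ?y' = "\<lambda>t. N - fluid \<tau> \<alpha> e0' ?m t"
  have x: "?x t - ?x' t = q0 - q0'" for t
    using fluid_shift[of \<tau> lam q0 ?r t q0'] by simp
  have y: "?y t - ?y' t = e0' - e0" for t
    using fluid_shift[of \<tau> \<alpha> e0 ?m t e0'] by simp
  have L: "reflection ?x L" and U: "reflection ?y U"
    using tr by (simp_all add: minimal_reflection_def)
  have mx: "mono_on {0..} (\<lambda>t. ?x t - ?x' t)" and my: "mono_on {0..} (\<lambda>t. ?y t - ?y' t)"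
    unfolding x y by (simp_all add: mono_on_def)
  obtain L' where L': "minimal_reflection ?x' L'"
    using minimal_reflection_exists[OF reflection_transfer[OF L mx]] assms by auto
  obtain U' where U': "minimal_reflection ?y' U'"
    using minimal_reflection_exists[OF reflection_transfer[OF U my]] assms by auto
  define q' e' where "q' t = ?x' t + L' t" and "e' t = fluid \<tau> \<alpha> e0' ?m t - U' t" for t
  have le_q: "q' t \<le> q t" if "0 \<le> t" for t
    using minimal_reflection_mono[OF L' L mx _ that] tr that assms by (simp add: q'_def)
  have ge_e: "e t \<le> e' t" if "0 \<le> t" for t
    using minimal_reflection_mono[OF U' U my _ that] tr that assms by (simp add: e'_def)
  have start: "q' 0 = q0'" "e' 0 = e0'"
    using L' U' by (simp_all add: q'_def e'_def minimal_reflection_def reflection_def)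
  have r: "mean_rate (replay \<Omega> q0' e0' q e) q' e' t = ?r t"
    and m: "mean_power (replay \<Omega> q0' e0' q e) q' e' t = ?m t" if "0 \<le> t" for t
    using ge_e[OF that] by (simp_all add: mean_replay start)
  have st: "(q' t, e' t) \<in> state_space N" if "0 \<le> t" for t
  proof -
    have "0 \<le> e t" using tr that by (auto simp: state_space_def)
    moreover have "0 \<le> q' t" using L' that
      by (simp add: q'_def minimal_reflection_def reflection_def)
    moreover have "e' t \<le> N" using U' that
      by (auto simp: e'_def minimal_reflection_def reflection_def algebra_simps)
    ultimately show ?thesis using ge_e[OF that] by (simp add: state_space_def)
  qed
  have int: "set_integrable lborel {0..T} (mean_rate (replay \<Omega> q0' e0' q e) q' e')"
    "set_integrable lborel {0..T} (mean_power (replay \<Omega> q0' e0' q e) q' e')" if "0 \<le> T" for T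
  proof -
    have "set_integrable lborel {0..T} (mean_rate (replay \<Omega> q0' e0' q e) q' e')
        = set_integrable lborel {0..T} ?r"
      "set_integrable lborel {0..T} (mean_power (replay \<Omega> q0' e0' q e) q' e')
        = set_integrable lborel {0..T} ?m"
      by (rule set_integrable_cong; simp add: r m)+
    then show "set_integrable lborel {0..T} (mean_rate (replay \<Omega> q0' e0' q e) q' e')"
      "set_integrable lborel {0..T} (mean_power (replay \<Omega> q0' e0' q e) q' e')"
      using tr that by simp_all
  qed
  have fl: "fluid \<tau> lam q0' (mean_rate (replay \<Omega> q0' e0' q e) q' e') = ?x'"
    "fluid \<tau> \<alpha> e0' (mean_power (replay \<Omega> q0' e0' q e) q' e') = fluid \<tau> \<alpha> e0' ?m"
    by (rule fluid_cong; simp add: r m)+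
  have "trajectory \<tau> lam \<alpha> N (replay \<Omega> q0' e0' q e) q0' e0' q' e' L' U'"
    unfolding trajectory_fluid fl
    using st int L' U' by (simp add: q'_def e'_def)
  moreover have "q' t = q t - L t + L' t + (q0' - q0)" if "0 \<le> t" for t
    using tr that x[of t] by (simp add: q'_def)
  ultimately show thesis
    using le_q that by blast
qed

text \<open>Along any trajectory of the replay the switch is on, so the mean drains are the recorded
  ones. Both trajectories then have the same free paths, and minimal reflections are unique.\<close>

lemma replay_trajectory_unique:
  assumes "0 \<le> \<tau>" and "virtual_policy \<tau> N \<Omega>" and tr: "trajectory \<tau> lam \<alpha> N \<Omega> q0 e0 q e L U"
    and tr1: "trajectory \<tau> lam \<alpha> N (replay \<Omega> q0' e0' q e) q0' e0' q1 e1 L1 U1"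
    and tr2: "trajectory \<tau> lam \<alpha> N (replay \<Omega> q0' e0' q e) q0' e0' q2 e2 L2 U2"
    and "e0 \<le> e0'" and "0 \<le> t"
  shows "q1 t = q2 t" and "e1 t = e2 t"
proof -
  have m: "mean_rate (replay \<Omega> q0' e0' q e) q' e' s = mean_rate \<Omega> q e s"
    "mean_power (replay \<Omega> q0' e0' q e) q' e' s = mean_power \<Omega> q e s"
    if "trajectory \<tau> lam \<alpha> N (replay \<Omega> q0' e0' q e) q0' e0' q' e' L' U'" "0 \<le> s"
    for q' e' L' U' s
    using replay_energy_ge[OF assms(1-3) that(1) assms(6) that(2)]
    by (simp_all add: mean_replay trajectory_start[OF that(1)])
  have fl: "fluid \<tau> lam q0' (mean_rate (replay \<Omega> q0' e0' q e) q' e') = fluid \<tau> lam q0' (mean_rate \<Omega> q e)"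
    "fluid \<tau> \<alpha> e0' (mean_power (replay \<Omega> q0' e0' q e) q' e') = fluid \<tau> \<alpha> e0' (mean_power \<Omega> q e)"
    if "trajectory \<tau> lam \<alpha> N (replay \<Omega> q0' e0' q e) q0' e0' q' e' L' U'" for q' e' L' U'
    by (rule fluid_cong; simp add: m[OF that])+
  show "q1 t = q2 t" "e1 t = e2 t"
    using tr1[unfolded trajectory_fluid fl[OF tr1]] tr2[unfolded trajectory_fluid fl[OF tr2]]
      minimal_reflection_unique[OF _ _ \<open>0 \<le> t\<close>] \<open>0 \<le> t\<close> by metis+
qed

section \<open>Monotonicity of the optimal cost in the initial state\<close>

lemma cost_replay:
  assumes pos: "0 < \<tau>" "0 < lam" and adm: "admissible \<tau> lam \<alpha> N \<Omega>"
    and tr: "trajectory \<tau> lam \<alpha> N \<Omega> q0 e0 q e L U"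
    and start: "0 \<le> q0'" "q0' \<le> q0" "e0 \<le> e0'" "e0' \<le> N"
  shows "\<exists>c\<in>achievable_costs \<tau> lam \<alpha> N q0' e0'. c \<le> (LINT t:{0..}|lborel. q t / lam)"
proof -
  let ?R = "replay \<Omega> q0' e0' q e"
  have vp: "virtual_policy \<tau> N \<Omega>"
    using adm by (simp add: admissible_def)
  note st = trajectory_state[OF tr]
  have "(q0, e0) \<in> state_space N"
    using st[of 0] trajectory_start[OF tr] by simp
  then have int: "set_integrable lborel {0..} q"
    using adm tr unfolding admissible_def by blast
  obtain q' e' L' U' where tr': "trajectory \<tau> lam \<alpha> N ?R q0' e0' q' e' L' U'"
    and le: "\<And>t. 0 \<le> t \<Longrightarrow> q' t \<le> q t"
    and eq: "\<And>t. 0 \<le> t \<Longrightarrow> q' t = q t - L t + L' t + (q0' - q0)"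
    using replay_trajectory_exists[OF tr start] by blast
  have nonneg: "0 \<le> q' t" if "0 \<le> t" for t
    using tr' that by (auto simp: trajectory_fluid state_space_def)
  have mono: "mono_on {0..} L" "mono_on {0..} L'"
    using tr tr' by (simp_all add: trajectory_fluid minimal_reflection_def reflection_def)
  have int': "set_integrable lborel {0..} q'"
    using le nonneg eq by (intro integrable_reflected[OF int mono]) auto
  have unique: "q1 t = q2 t \<and> e1 t = e2 t"
    if "trajectory \<tau> lam \<alpha> N ?R q0' e0' q1 e1 L1 U1"
      "trajectory \<tau> lam \<alpha> N ?R q0' e0' q2 e2 L2 U2" "0 \<le> t" for q1 e1 L1 U1 q2 e2 L2 U2 t
    using replay_trajectory_unique[OF _ vp tr that(1,2) start(3) that(3)] pos by simp
  \<comment> \<open>Uniqueness carries integrability from the constructed trajectory to every other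
    one with this start.\<close>
  have int1: "set_integrable lborel {0..} q1"
    if "trajectory \<tau> lam \<alpha> N ?R q0' e0' q1 e1 L1 U1" for q1 e1 L1 U1
  proof -
    have "set_integrable lborel {0..} q1 = set_integrable lborel {0..} q'"
      using unique[OF that tr'] by (intro set_integrable_cong) auto
    then show ?thesis using int' by simp
  qed
  have "admissible \<tau> lam \<alpha> N ?R"
    unfolding admissible_def
  proof (intro conjI ballI, goal_cases)
    case 1
    show ?case using replay_virtual_policy[OF vp st] .
  next
    case (2 z)
    obtain a b where z: "z = (a, b)" by (cases z)
    show ?case
    \<comment> \<open>Only the replayed initial state needs an argument; from any other one the
      trajectories are those of \<open>\<Omega>\<close>.\<close>
    proof (cases "a = q0' \<and> b = e0'")
      case True
      then show ?thesis using tr' unique int1 unfolding z by blast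
    next
      case False
      show ?thesis
        using bspec[OF conjunct2[OF adm[unfolded admissible_def]] 2]
        unfolding z prod.case trajectory_replay_other[OF False] .
    qed
  qed
  then have "(LINT t:{0..}|lborel. q' t / lam) \<in> achievable_costs \<tau> lam \<alpha> N q0' e0'"
    using tr' unfolding achievable_costs_def by blast
  moreover have "(LINT t:{0..}|lborel. q' t / lam) \<le> (LINT t:{0..}|lborel. q t / lam)"
    using int int' le pos by (intro set_integral_mono) (auto simp: divide_right_mono)
  ultimately show ?thesis by blast
qed

text \<open>The minimum is attained, so some trajectory costs exactly \<open>V q0 e0\<close>;
  replaying it from the better state costs no more.\<close>

lemma optimal_total_cost_mono:
  assumes "0 < \<tau>" "0 < lam" and opt: "optimal_total_cost \<tau> lam \<alpha> N V"
    and "0 \<le> q0'" "q0' \<le> q0" "0 \<le> e0" "e0 \<le> e0'" "e0' \<le> N"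
  shows "V q0' e0' \<le> V q0 e0"
proof -
  have "V q0 e0 \<in> achievable_costs \<tau> lam \<alpha> N q0 e0"
    using opt assms by (auto simp: optimal_total_cost_def state_space_def)
  then obtain \<Omega> q e L U where "admissible \<tau> lam \<alpha> N \<Omega>" "trajectory \<tau> lam \<alpha> N \<Omega> q0 e0 q e L U"
    and V: "V q0 e0 = (LINT t:{0..}|lborel. q t / lam)"
    by (auto simp: achievable_costs_def)
  then obtain c where "c \<in> achievable_costs \<tau> lam \<alpha> N q0' e0'" "c \<le> V q0 e0"
    using cost_replay[of \<tau> lam \<alpha> N \<Omega> q0 e0 q e L U q0' e0'] assms by auto
  moreover have "V q0' e0' \<le> c"
    using opt assms calculation by (auto simp: optimal_total_cost_def state_space_def)
  ultimately show ?thesis by simp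
qed

section \<open>Signs of the partial derivatives\<close>

text \<open>All difference quotients are nonnegative, and so is their limit. A general
  \<open>S\<close> covers one-sided derivatives at boundary points.\<close>

lemma mono_on_derivative_nonneg:
  fixes f :: "real \<Rightarrow> real"
  assumes mono: "mono_on S f" and "x \<in> S" and nontrivial: "at x within S \<noteq> bot"
    and "(f has_real_derivative D) (at x within S)"
  shows "0 \<le> D"
proof -
  have "((\<lambda>y. (f y - f x) / (y - x)) \<longlongrightarrow> D) (at x within S)"
    using assms(4) unfolding has_field_derivative_iff .
  moreover have "\<forall>\<^sub>F y in at x within S. 0 \<le> (f y - f x) / (y - x)"
    unfolding eventually_at_filter
  proof (rule always_eventually, intro allI impI)
    fix y
    assume "y \<in> S"
    show "0 \<le> (f y - f x) / (y - x)"
    proof (cases "x \<le> y")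
      case True
      then show ?thesis
        using mono_onD[OF mono \<open>x \<in> S\<close> \<open>y \<in> S\<close>] by simp
    next
      case False
      then show ?thesis
        using mono_onD[OF mono \<open>y \<in> S\<close> \<open>x \<in> S\<close>] by (simp add: divide_nonpos_nonpos)
    qed
  qed
  ultimately show ?thesis
    using tendsto_lowerbound nontrivial by blast
qed

lemma at_within_connected_neq_bot:
  fixes x :: "'a::metric_space"
  assumes "connected S" and "x \<in> S" and "y \<in> S" and "y \<noteq> x"
  shows "at x within S \<noteq> bot"
proof -
  have "x islimpt S"
    using assms by (intro connected_imp_perfect) auto
  then show ?thesis by (simp add: trivial_limit_within)
qed

lemma C1_quadrant_derivatives:
  assumes "C1_quadrant V" and "0 \<le> q" and "0 \<le> e"
  shows "((\<lambda>x. V x e) has_real_derivative d_q V q e) (at q within {0..})"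
    and "((\<lambda>y. V q y) has_real_derivative d_e V q e) (at e within {0..})"
  using assms unfolding C1_quadrant_def d_q_def d_e_def
  by (simp_all add: has_real_derivative_iff_has_vector_derivative vector_derivative_works[symmetric])

lemma virtual_priority_signs:
  assumes pos: "0 < \<tau>" "0 < lam" "0 < N" and V: "virtual_priority \<tau> lam \<alpha> N V"
    and "(q, e) \<in> state_space N"
  shows "0 \<le> d_q V q e" and "d_e V q e \<le> 0"
proof -
  have qe: "0 \<le> q" "0 \<le> e" "e \<le> N"
    using assms(5) by (auto simp: state_space_def)
  have C1: "C1_quadrant V" and mono: "\<And>q0 q0' e0 e0'. 0 \<le> q0' \<Longrightarrow> q0' \<le> q0 \<Longrightarrow>
      0 \<le> e0 \<Longrightarrow> e0 \<le> e0' \<Longrightarrow> e0' \<le> N \<Longrightarrow> V q0' e0' \<le> V q0 e0"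
    using V optimal_total_cost_mono[OF pos(1,2)] by (auto simp: virtual_priority_def)
  note der = C1_quadrant_derivatives[OF C1 qe(1,2)]
  have "at q within {0..} \<noteq> bot"
    using qe by (intro at_within_connected_neq_bot[where y = "q + 1"]) auto
  then show "0 \<le> d_q V q e"
    using qe by (intro mono_on_derivative_nonneg[OF _ _ _ der(1)]) (auto intro!: mono_onI mono)
  \<comment> \<open>Monotonicity in the energy is known only up to \<open>N\<close>, so the
    derivative within \<open>{0..}\<close> is restricted to \<open>{0..N}\<close>, where it is
    one-sided at \<open>e = N\<close>.\<close>
  have "((\<lambda>y. - V q y) has_real_derivative - d_e V q e) (at e within {0..N})"
    by (intro derivative_intros DERIV_subset[OF der(2)]) auto
  moreover have "at e within {0..N} \<noteq> bot"
    using qe pos by (intro at_within_connected_neq_bot[where y = "if e = 0 then N else 0"]) auto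
  ultimately have "0 \<le> - d_e V q e"
    using qe by (intro mono_on_derivative_nonneg[where f = "\<lambda>y. - V q y" and S = "{0..N}"])
      (auto intro!: mono_onI mono)
  then show "d_e V q e \<le> 0" by simp
qed

section \<open>Water-filling\<close>

lemma is_arg_min_strict:
  fixes f :: "'a \<Rightarrow> 'b::linorder"
  assumes "P x" and "\<And>y. P y \<Longrightarrow> y \<noteq> x \<Longrightarrow> f x < f y"
  shows "is_arg_min f P x" and "is_arg_min f P y \<Longrightarrow> y = x"
  using assms by (force simp: is_arg_min_linorder)+

text \<open>The infinite water level survives the subtraction even at \<open>h = 0\<close>, where
  \<open>\<infinity> - \<infinity> = \<infinity>\<close>, so the cap decides.\<close>

lemma opt_power_flat:
  assumes "d_e V q e = 0"
  shows "opt_power \<tau> V q e h = e / \<tau>"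
proof -
  have "\<infinity> - 1 / ereal ((cmod h)\<^sup>2) = \<infinity>"
    by simp
  then show ?thesis
    using assms by (simp add: opt_power_def water_level_def)
qed

text \<open>Passing from \<open>ereal\<close> to \<open>real\<close> needs a separate branch at
  \<open>h = 0\<close>: there \<open>1 / 0\<close> is infinite in \<open>ereal\<close> but 0 in
  \<open>real\<close>.\<close>

lemma opt_power_steep:
  assumes "d_e V q e < 0" and "0 \<le> e / \<tau>"
  shows "opt_power \<tau> V q e h = (if h = 0 then 0 else
    min (max (- d_q V q e / d_e V q e - 1 / (cmod h)\<^sup>2) 0) (e / \<tau>))"
proof (cases "h = 0")
  case True
  then show ?thesis
    using assms by (simp add: opt_power_def water_level_def divide_ereal_def min_absorb1)
next
  case False
  then show ?thesis
    using assms
    by (simp add: opt_power_def water_level_def zero_ereal_def one_ereal_def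
        flip: ereal_max ereal_min del: ereal_max ereal_min)
qed

text \<open>
  The tangent bound \<open>ln z \<le> z - 1\<close> at \<open>z = (1 + p c) / (1 + p0 c)\<close> turns the claim into a sign
  condition on the slope of the objective at the optimal power \<open>p0\<close>.
\<close>

lemma water_filling_strict:
  fixes a b c E p :: real
  assumes "0 \<le> a" and "b < 0" and "0 < c" and "0 \<le> p" "p \<le> E"
  defines "p0 \<equiv> min (max (- a / b - 1 / c) 0) E"
  assumes "p \<noteq> p0"
  shows "- a * ln (1 + p0 * c) - b * p0 < - a * ln (1 + p * c) - b * p"
proof -
  have p0: "0 \<le> p0" "p0 \<le> E"
    using assms(4,5) by (auto simp: p0_def)
  \<comment> \<open>The derivative of \<open>- a * ln (1 + p * c) - b * p\<close> at
    \<open>p = p0\<close>.\<close>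
  define s where "s = - b - a * c / (1 + p0 * c)"
  have z: "0 < 1 + p0 * c" "0 < 1 + p * c"
    using assms p0 by (auto intro: add_pos_nonneg)
  \<comment> \<open>First-order condition on \<open>[0, E]\<close>: the slope is zero at an uncapped
    water level, nonnegative at \<open>p0 = 0\<close> and nonpositive at
    \<open>p0 = E\<close>.\<close>
  have slope: "0 \<le> (p - p0) * s"
  proof -
    consider "p0 = - a / b - 1 / c" | "p0 = 0" "- a / b \<le> 1 / c" | "p0 = E" "E \<le> - a / b - 1 / c"
      using assms(4,5) unfolding p0_def
      by (cases "- a / b - 1 / c \<le> 0"; cases "- a / b - 1 / c \<le> E") auto
    then show ?thesis
    proof cases
      case 1
      then have "1 + p0 * c = - a * c / b"
        using assms by (simp add: field_simps)
      then have "s = 0"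
        using z assms by (simp add: s_def field_simps)
      then show ?thesis by simp
    next
      case 2
      then have "0 \<le> s"
        using assms by (simp add: s_def field_simps)
      then show ?thesis using 2 assms by simp
    next
      case 3
      then have "p0 * c \<le> (- a / b - 1 / c) * c"
        using assms by (intro mult_right_mono) auto
      then have "1 + p0 * c \<le> - a * c / b"
        using \<open>0 < c\<close> by (simp add: left_diff_distrib)
      then have "s \<le> 0"
        using z assms by (simp add: s_def field_simps)
      then show ?thesis using 3 assms by (simp add: mult_nonpos_nonpos)
    qed
  qed
  have ratio: "(1 + p * c) / (1 + p0 * c) - 1 = (p - p0) * c / (1 + p0 * c)"
    using z by (simp add: field_simps)
  show ?thesis
  \<comment> \<open>For \<open>a = 0\<close> the logarithm contributes nothing, and strictness comes
    from the linear term \<open>- b * p\<close>.\<close>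
  proof (cases "a = 0")
    case True
    then have "p0 = 0"
      using assms p0 by (auto simp: p0_def)
    then show ?thesis
      using True assms by (simp add: mult_neg_pos)
  next
    case False
    \<comment> \<open>The tangent bound is an equality only at \<open>z = 1\<close>, which
      \<open>p \<noteq> p0\<close> excludes.\<close>
    have "(1 + p * c) / (1 + p0 * c) \<noteq> 1"
      using z assms by (simp add: field_simps)
    then have "ln ((1 + p * c) / (1 + p0 * c)) < (p - p0) * c / (1 + p0 * c)"
      using z ln_eq_minus_one[of "(1 + p * c) / (1 + p0 * c)"]
        ln_le_minus_one[of "(1 + p * c) / (1 + p0 * c)"] unfolding ratio
      by (metis divide_pos_pos order_le_imp_less_or_eq ratio)
    then have "a * (ln (1 + p * c) - ln (1 + p0 * c)) < a * ((p - p0) * c / (1 + p0 * c))"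
      using z False \<open>0 \<le> a\<close> by (intro mult_strict_left_mono) (simp_all add: ln_div)
    \<comment> \<open>By definition of \<open>s\<close>, the bound on the right equals
      \<open>(p - p0) * (- b - s)\<close>, and the slope condition removes \<open>s\<close>.\<close>
    then show ?thesis
      using slope by (simp add: s_def algebra_simps)
  qed
qed

section \<open>The minimiser of the HJB objective\<close>

theorem corollary1:
  fixes \<tau> lam \<alpha> N :: real and V :: "real \<Rightarrow> real \<Rightarrow> real"
    and h :: complex and q e :: real
  assumes "\<tau> > 0" and "lam > 0" and "\<alpha> > 0" and "N > 0"
    and "virtual_priority \<tau> lam \<alpha> N V"
    and "(q, e) \<in> state_space N"
  shows "is_arg_min (hjb_objective \<tau> lam \<alpha> V q e h) (\<lambda>p. p \<in> {0..e / \<tau>})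
           (opt_power \<tau> V q e h) \<and>
         (\<forall>p. is_arg_min (hjb_objective \<tau> lam \<alpha> V q e h) (\<lambda>p. p \<in> {0..e / \<tau>}) p \<longrightarrow>
              p = opt_power \<tau> V q e h \<or>
              (d_e V q e = 0 \<and> (d_q V q e = 0 \<or> h = 0)))"
proof -
  let ?f = "hjb_objective \<tau> lam \<alpha> V q e h" and ?P = "\<lambda>p. p \<in> {0..e / \<tau>}"
    and ?p = "opt_power \<tau> V q e h" and ?a = "d_q V q e" and ?b = "d_e V q e" and ?c = "(cmod h)\<^sup>2"
  have E: "0 \<le> e / \<tau>"
    using assms by (auto simp: state_space_def)
  have a: "0 \<le> ?a" and b: "?b \<le> 0"
    using virtual_priority_signs[of \<tau> lam N \<alpha> V q e] assms by auto
  have f: "?f p < ?f p' \<longleftrightarrow> - ?a * ln (1 + p * ?c) - ?b * p < - ?a * ln (1 + p' * ?c) - ?b * p'"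
    for p p'
    by (simp add: hjb_objective_def rate_def algebra_simps)
  show ?thesis
  \<comment> \<open>In the exceptional case the objective does not depend on the power, so every
    feasible power is a minimiser. Otherwise the formula is shown to be a strict minimiser, which
    also gives uniqueness.\<close>
  proof (cases "?b = 0 \<and> (?a = 0 \<or> h = 0)")
    case True
    then have "?f p = ?f p'" for p p'
      by (auto simp: hjb_objective_def rate_def)
    then have "?f p \<le> ?f p'" for p p'
      by (metis order_refl)
    then show ?thesis
      using True E by (auto simp: is_arg_min_linorder opt_power_flat)
  next
    case False
    have "?P ?p"
      using E b by (cases "?b = 0") (auto simp: opt_power_flat opt_power_steep)
    moreover have "?f ?p < ?f p" if "?P p" "p \<noteq> ?p" for p
    proof -
      consider "?b = 0" "0 < ?a" "h \<noteq> 0" | "?b < 0" "h = 0" | "?b < 0" "h \<noteq> 0"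
        using a b False by fastforce
      then show ?thesis
      proof cases
        \<comment> \<open>Power has no price and a positive reward, so the objective is strictly
          decreasing and the cap is optimal.\<close>
        case 1
        then have "p < e / \<tau>" and "0 \<le> p" and "0 < ?c"
          using that by (auto simp: opt_power_flat)
        then have "1 + p * ?c < 1 + e / \<tau> * ?c" and "0 < 1 + p * ?c"
          by (auto intro: add_pos_nonneg simp del: times_divide_eq_left)
        then show ?thesis
          unfolding f using 1 by (simp add: opt_power_flat)
      next
        \<comment> \<open>The rate vanishes at \<open>h = 0\<close>, so the objective is strictly
          increasing in the power and 0 is optimal.\<close>
        case 2
        then show ?thesis
          unfolding f using that E by (simp add: opt_power_steep mult_neg_pos)
      next
        case 3
        then show ?thesis
          unfolding f using that E a
          by (simp add: opt_power_steep water_filling_strict[simplified])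
      qed
    qed
    ultimately show ?thesis
      using is_arg_min_strict[of ?P ?p ?f] by blast
  qed
qed

end
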